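(* Suppose that the $(d-1)$-homogeneous polynomial map $F=(F_1,\dots,F_n):\mathbb{R}_{>0}^n\to\mathbb{R}_{>0}^n$ is weakly irreducible. Let $f(x)=\max_{i\in[n]}(\log F_i(\exp(x))-(d-1)x_i)$ for $x\in\mathbb{R}^n$. Then the restriction of $f$ to the hyperplane $E_n=\{x\in\mathbb{R}^n: x_n=0\}$ is coercive; moreover, $$\nu(\mathcal{A},E_n)\ge\big(4(d-1)^2+1\big)^{-(n-1)/2}.$$
   Context: $d\ge2$ is an integer, $[n]=\{1,\dots,n\}$, $\exp$ of a vector is entrywise. $F_i(z)=\sum_{b\in\mathcal{B}_i}f_{b,i}z^b$, where $z^b=z_1^{b_1}\cdots z_n^{b_n}$, each $\mathcal{B}_i$ is a nonempty finite set of vectors $b\in\mathbb{Z}_{\ge0}^n$ with $\sum_k b_k=d-1$, and the $f_{b,i}$ are positive rationals. $F$ is weakly irreducible if the Jacobian matrix of $F$ at $\mathbf{1}=(1,\dots,1)^\top$ is an irreducible matrix. Set $\mathcal{A}_i=\{b-(d-1)e_i: b\in\mathcal{B}_i\}$ with $e_i$ the $i$-th canonical basis vector, and $\mathcal{A}=\bigcup_{i\in[n]}\mathcal{A}_i$ (these are the exponents occurring in $f$). The coercivity constant relative to a subspace $E$ is $\nu(\mathcal{A},E)=\min_{x\in E,\ \|x\|_\infty=1}\max\{a^\top x: a\in\mathcal{A}\}$ (a minimum over the empty set, which occurs only for $n=1$, is $+\infty$). A function on $E$ is coercive if all its sublevel sets are compact. *)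

theory Defs
  imports "HOL-Analysis.Analysis"
begin

definition monomial_vec :: "real ^ 'n \<Rightarrow> nat ^ 'n \<Rightarrow> real"
  where "monomial_vec z b = (\<Prod>k\<in>UNIV. (z $ k) ^ (b $ k))"

text \<open>
  The coefficient of the monomial \<^term>\<open>b\<close> in the \<^term>\<open>i\<close>-th component is \<^term>\<open>c i b\<close>; only its values
  for \<^term>\<open>b \<in> B i\<close> matter. The polynomial map is defined on all of \<open>real ^ 'n\<close>, although only its
  values on the open positive orthant are of interest.
\<close>

definition poly_map ::
    "('n \<Rightarrow> (nat ^ 'n) set) \<Rightarrow> ('n \<Rightarrow> nat ^ 'n \<Rightarrow> rat) \<Rightarrow> real ^ 'n \<Rightarrow> real ^ 'n"
  where "poly_map B c z = (\<chi> i. \<Sum>b\<in>B i. of_rat (c i b) * monomial_vec z b)"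

definition irreducible_matrix :: "real ^ 'n ^ 'n \<Rightarrow> bool"
  where "irreducible_matrix A \<longleftrightarrow>
    \<not> (\<exists>I. I \<noteq> {} \<and> I \<noteq> UNIV \<and> (\<forall>i\<in>I. \<forall>j\<in>- I. A $ i $ j = 0))"

text \<open>The point \<^term>\<open>1\<close> of \<open>real ^ 'n\<close> is the vector all of whose entries are one.\<close>

definition weakly_irreducible :: "(real ^ 'n \<Rightarrow> real ^ 'n) \<Rightarrow> bool"
  where "weakly_irreducible F \<longleftrightarrow> irreducible_matrix (jacobian F (at 1))"

definition exp_vec :: "real ^ 'n \<Rightarrow> real ^ 'n"
  where "exp_vec x = (\<chi> k. exp (x $ k))"

definition log_max_fun :: "nat \<Rightarrow> (real ^ 'n \<Rightarrow> real ^ 'n) \<Rightarrow> real ^ 'n \<Rightarrow> real"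
  where "log_max_fun d F x = (MAX i. ln (F (exp_vec x) $ i) - (real d - 1) * x $ i)"

definition exponents_at :: "nat \<Rightarrow> ('n \<Rightarrow> (nat ^ 'n) set) \<Rightarrow> 'n \<Rightarrow> (real ^ 'n) set"
  where "exponents_at d B i = (\<lambda>b. (\<chi> k. real (b $ k)) - (real d - 1) *\<^sub>R axis i 1) ` B i"

definition exponents :: "nat \<Rightarrow> ('n \<Rightarrow> (nat ^ 'n) set) \<Rightarrow> (real ^ 'n) set"
  where "exponents d B = (\<Union>i. exponents_at d B i)"

text \<open>The index set is a finite linear order; its greatest element plays the role of the index \<open>n\<close>.\<close>

definition last_hyperplane :: "(real ^ 'n::{finite,linorder}) set"
  where "last_hyperplane = {x. x $ Max UNIV = 0}"

definition coercive_on :: "'a::topological_space set \<Rightarrow> ('a \<Rightarrow> real) \<Rightarrow> bool"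
  where "coercive_on E g \<longleftrightarrow> (\<forall>\<alpha>. compact {x\<in>E. g x \<le> \<alpha>})"

text \<open>
  The coercivity constant takes extended real values, so that it is \<open>\<infinity>\<close> when no \<^term>\<open>x \<in> E\<close> has
  sup-norm one. Otherwise the infimum is a minimum when \<^term>\<open>A\<close> is finite and nonempty, see below.
\<close>

definition coercivity_const :: "(real ^ 'n) set \<Rightarrow> (real ^ 'n) set \<Rightarrow> ereal"
  where "coercivity_const A E = (INF x\<in>{x\<in>E. infnorm x = 1}. ereal (MAX a\<in>A. a \<bullet> x))"

lemma coercivity_const_empty:
  assumes "\<And>x. x \<in> E \<Longrightarrow> infnorm x \<noteq> 1"
  shows "coercivity_const A E = \<infinity>"
proof -
  have empty: "{x\<in>E. infnorm x = 1} = {}" using assms by auto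
  show ?thesis
    unfolding coercivity_const_def empty by (simp add: top_ereal_def)
qed

lemma continuous_on_Max_inner:
  assumes "finite A" "A \<noteq> {}"
  shows "continuous_on S (\<lambda>x::real ^ 'n. MAX a\<in>A. a \<bullet> x)"
  using assms
proof (induction A rule: finite_ne_induct)
  case (singleton a)
  show ?case by (simp add: continuous_intros)
next
  case (insert a A)
  have "(\<lambda>x. MAX a\<in>insert a A. a \<bullet> x) = (\<lambda>x. max (a \<bullet> x) (MAX a\<in>A. a \<bullet> x))"
    using insert.hyps by (simp add: fun_eq_iff)
  moreover have "continuous_on S (\<lambda>x. max (a \<bullet> x) (MAX a\<in>A. a \<bullet> x))"
    by (intro continuous_on_max continuous_intros insert.IH)
  ultimately show ?case by (simp only:)
qed

lemma coercivity_const_attained: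
  fixes E :: "(real ^ 'n) set"
  assumes A: "finite A" "A \<noteq> {}" and E: "subspace E" "{x\<in>E. infnorm x = 1} \<noteq> {}"
  obtains x where "x \<in> E" "infnorm x = 1" "coercivity_const A E = ereal (MAX a\<in>A. a \<bullet> x)"
    "\<And>y. y \<in> E \<Longrightarrow> infnorm y = 1 \<Longrightarrow> (MAX a\<in>A. a \<bullet> x) \<le> (MAX a\<in>A. a \<bullet> y)"
proof -
  let ?S = "{x\<in>E. infnorm x = 1}"
  have "bounded {x::real ^ 'n. infnorm x = 1}"
    unfolding bounded_iff
    by (rule exI[of _ "sqrt DIM(real ^ 'n)"]) (metis mem_Collect_eq mult.right_neutral norm_le_infnorm)
  moreover have "closed {x::real ^ 'n. infnorm x = 1}"
    by (intro closed_Collect_eq continuous_on_infnorm continuous_intros)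
  ultimately have "compact (E \<inter> {x. infnorm x = 1})"
    by (intro closed_Int_compact closed_subspace E) (simp add: compact_eq_bounded_closed)
  then have "compact ?S" by (simp add: Collect_conj_eq)
  from continuous_attains_inf[OF this E(2) continuous_on_Max_inner[OF A]]
  obtain x where x: "x \<in> ?S" "\<forall>y\<in>?S. (MAX a\<in>A. a \<bullet> x) \<le> (MAX a\<in>A. a \<bullet> y)" by blast
  have "coercivity_const A E = ereal (MAX a\<in>A. a \<bullet> x)"
    unfolding coercivity_const_def
    by (rule antisym[OF INF_lower[OF x(1)] INF_greatest]) (use x in auto)
  with x that show ?thesis by blast
qed

end

theory Submission
  imports Defs
begin

text \<open>
  Write \<open>D = d - 1\<close>, and let \<open>i \<rightarrow> j\<close> mean that the variable \<open>z\<^sub>j\<close> occurs in \<open>F\<^sub>i\<close>; weak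
  irreducibility says that no proper nonempty set of indices is closed under \<open>\<rightarrow>\<close>. Suppose
  \<open>a\<^sup>T x \<le> \<epsilon>\<close> for all exponents \<open>a = b - D e\<^sub>i\<close>, and put \<open>y = x - min x \<ge> 0\<close>. Since the entries
  of \<open>b\<close> sum to \<open>D\<close>, this reads \<open>\<Sum>\<^sub>k b\<^sub>k y\<^sub>k \<le> \<epsilon> + D y\<^sub>i\<close>, so that \<open>y\<^sub>j \<le> \<epsilon> + D y\<^sub>i\<close> whenever
  \<open>i \<rightarrow> j\<close>. Starting from a minimal entry of \<open>x\<close> one reaches all indices in at most \<open>n - 1\<close> steps,
  hence \<open>y \<le> \<epsilon> (1 + D)\<^bsup>n-1\<^esup>\<close>. On the hyperplane \<open>x\<^sub>n = 0\<close> the entries of \<open>y\<close> dominate the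
  sup-norm of \<open>x\<close>, and \<open>(1 + D)\<^sup>2 \<le> 4 D\<^sup>2 + 1\<close>. Coercivity follows because \<open>f\<close> differs from
  the maximum of the \<open>a\<^sup>T x\<close> by a bounded amount.
\<close>

section \<open>Growth along a connected relation\<close>

text \<open>The sublevel sets \<open>I l\<close> gain at least one index per step until they are
  everything: an edge leaving \<open>I l\<close> ends in \<open>I (Suc l)\<close>.\<close>

lemma growth_bound_of_connected:
  fixes y :: "'n::finite \<Rightarrow> real"
  assumes conn: "\<And>I. I \<noteq> {} \<Longrightarrow> I \<noteq> UNIV \<Longrightarrow> \<exists>i\<in>I. \<exists>j\<in>-I. R i j"
    and step: "\<And>i j. R i j \<Longrightarrow> y j \<le> \<epsilon> + D * y i"
    and root: "y m \<le> 0" and "\<epsilon> \<ge> 0" "D \<ge> 0"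
  shows "y k \<le> \<epsilon> * (1 + D) ^ (CARD('n) - 1)"
proof -
  define I where "I l = {i. y i \<le> \<epsilon> * (1 + D) ^ l}" for l
  have "m \<in> I l" for l
    using root \<open>\<epsilon> \<ge> 0\<close> \<open>D \<ge> 0\<close> unfolding I_def
    by (simp add: order_trans[of "y m" 0])
  then have nonempty: "I l \<noteq> {}" for l by blast
  have mono: "I l \<subseteq> I (Suc l)" for l
  proof
    fix i assume "i \<in> I l"
    then have "y i \<le> \<epsilon> * (1 + D) ^ l" by (simp add: I_def)
    also have "\<dots> \<le> \<epsilon> * (1 + D) ^ Suc l"
      using \<open>\<epsilon> \<ge> 0\<close> \<open>D \<ge> 0\<close> by (intro mult_left_mono power_increasing) auto
    finally show "i \<in> I (Suc l)" by (simp add: I_def)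
  qed
  \<comment> \<open>\<open>I 0\<close> already contains \<open>m\<close>, so the count stays
    strictly ahead of \<open>l\<close>, and \<open>CARD('n) - 1\<close> steps suffice instead of
    \<open>CARD('n)\<close>.\<close>
  have "l < CARD('n) \<longrightarrow> l < card (I l)" for l
  proof (induction l)
    case 0
    show ?case using nonempty[of 0] by (simp add: card_gt_0_iff)
  next
    case (Suc l)
    show ?case
    proof
      assume l: "Suc l < CARD('n)"
      show "Suc l < card (I (Suc l))"
      proof (cases "I l = UNIV")
        case True
        then have "I (Suc l) = UNIV" using mono[of l] by auto
        with l show ?thesis by simp
      next
        case False
        then obtain i j where ij: "i \<in> I l" "j \<notin> I l" "R i j"
          using conn[OF nonempty[of l]] by blast
        have "y j \<le> \<epsilon> + D * y i" by (rule step[OF ij(3)])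
        also have "\<dots> \<le> \<epsilon> * (1 + D) ^ l + D * (\<epsilon> * (1 + D) ^ l)"
        proof (rule add_mono)
          \<comment> \<open>The additive \<open>\<epsilon>\<close> is absorbed into the factor
            \<open>1 + D\<close>.\<close>
          have "\<epsilon> * 1 \<le> \<epsilon> * (1 + D) ^ l"
            using \<open>\<epsilon> \<ge> 0\<close> \<open>D \<ge> 0\<close> by (intro mult_left_mono one_le_power) auto
          then show "\<epsilon> \<le> \<epsilon> * (1 + D) ^ l" by simp
          show "D * y i \<le> D * (\<epsilon> * (1 + D) ^ l)"
            using ij(1) \<open>D \<ge> 0\<close> by (intro mult_left_mono) (auto simp: I_def)
        qed
        also have "\<dots> = \<epsilon> * (1 + D) ^ Suc l" by (simp add: algebra_simps)
        finally have "j \<in> I (Suc l)" by (simp add: I_def)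
        with ij(2) mono[of l] have "I l \<subset> I (Suc l)" by blast
        then have "card (I l) < card (I (Suc l))" by (simp add: psubset_card_mono)
        with Suc.IH l show ?thesis by simp
      qed
    qed
  qed
  from this[of "CARD('n) - 1"] have "CARD('n) \<le> card (I (CARD('n) - 1))" by simp
  then have "I (CARD('n) - 1) = UNIV"
    by (metis card_seteq finite subset_UNIV)
  then have "k \<in> I (CARD('n) - 1)" by simp
  then show ?thesis by (simp add: I_def)
qed

section \<open>The Jacobian at the all-ones vector\<close>

lemma has_derivative_vec_lambda:
  fixes f :: "'n::finite \<Rightarrow> 'a::real_normed_vector \<Rightarrow> real"
  assumes "\<And>i. (f i has_derivative f' i) (at x within S)"
  shows "((\<lambda>x. \<chi> i. f i x) has_derivative (\<lambda>h. \<chi> i. f' i h)) (at x within S)"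
  using assms
  by (subst has_derivative_componentwise_within) (auto simp: Basis_vec_def inner_axis)

text \<open>At \<open>1\<close> all powers of coordinates equal one, so the product rule leaves only
  the exponents as weights.\<close>

lemma has_derivative_poly_map:
  fixes B :: "'n::finite \<Rightarrow> (nat ^ 'n) set"
  shows "(poly_map B c has_derivative
    (\<lambda>h. \<chi> i. \<Sum>b\<in>B i. of_rat (c i b) * (\<Sum>k\<in>UNIV. real (b $ k) * h $ k))) (at 1)"
proof -
  have coord: "((\<lambda>z::real^'n. z $ k) has_derivative (\<lambda>h. h $ k)) (at 1)" for k
    by (rule bounded_linear_imp_has_derivative[OF bounded_linear_vec_nth])
  have "((\<lambda>z::real^'n. (z $ k) ^ m) has_derivative (\<lambda>h. real m * h $ k)) (at 1)" for k m
    using has_derivative_power[OF coord[of k], where n = m] by simp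
  then have "((\<lambda>z. monomial_vec z b) has_derivative
      (\<lambda>h. \<Sum>k\<in>UNIV. real (b $ k) * h $ k * (\<Prod>j\<in>UNIV - {k}. (1 $ j) ^ (b $ j)))) (at 1)"
    for b :: "nat ^ 'n"
    unfolding monomial_vec_def by (intro has_derivative_prod)
  then have mono: "((\<lambda>z. monomial_vec z b) has_derivative
      (\<lambda>h. \<Sum>k\<in>UNIV. real (b $ k) * h $ k)) (at 1)" for b :: "nat ^ 'n"
    by simp
  show ?thesis
    unfolding poly_map_def[abs_def]
    by (intro has_derivative_vec_lambda has_derivative_sum has_derivative_mult_right mono)
qed

text \<open>Entry \<open>(i, j)\<close> of the Jacobian is a weighted sum of the numbers
  \<open>b $ j\<close>, so if it is nonzero then one of these is positive. This provides the
  connectivity hypothesis of \<open>growth_bound_of_connected\<close>.\<close>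

lemma weakly_irreducible_poly_map_edge:
  fixes B :: "'n::finite \<Rightarrow> (nat ^ 'n) set"
  assumes "weakly_irreducible (poly_map B c)" "I \<noteq> {}" "I \<noteq> UNIV"
  shows "\<exists>i\<in>I. \<exists>j\<in>-I. \<exists>b\<in>B i. b $ j > 0"
proof -
  obtain i j where ij: "i \<in> I" "j \<in> - I" "jacobian (poly_map B c) (at 1) $ i $ j \<noteq> 0"
    using assms unfolding weakly_irreducible_def irreducible_matrix_def by blast
  have "jacobian (poly_map B c) (at 1) $ i $ j =
      (\<Sum>b\<in>B i. of_rat (c i b) * (\<Sum>k\<in>UNIV. real (b $ k) * axis j 1 $ k))"
    by (simp add: jacobian_def matrix_def
        frechet_derivative_at[OF has_derivative_poly_map, symmetric])
  also have "\<dots> = (\<Sum>b\<in>B i. of_rat (c i b) * real (b $ j))"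
    by (simp add: axis_def if_distrib cong: if_cong)
  finally have "\<exists>b\<in>B i. b $ j \<noteq> 0"
    using ij(3) by (metis (no_types, lifting) mult_zero_right of_nat_0 sum.neutral)
  with ij show ?thesis by blast
qed

section \<open>From exponent inequalities to a norm bound\<close>

lemma inner_exponent:
  fixes b :: "nat ^ 'n"
  shows "((\<chi> k. real (b $ k)) - D *\<^sub>R axis i 1) \<bullet> x =
    (\<Sum>k\<in>UNIV. real (b $ k) * x $ k) - D * x $ i"
proof -
  have "(\<chi> k. real (b $ k)) \<bullet> x = (\<Sum>k\<in>UNIV. real (b $ k) * x $ k)"
    by (simp add: inner_vec_def)
  then show ?thesis by (simp add: inner_diff_left inner_axis')
qed

text \<open>By homogeneity the entries of an exponent vector sum to zero, so adding a constant to
  all coordinates of \<open>x\<close> does not change the inner product.\<close>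

lemma inner_exponent_shift:
  fixes b :: "nat ^ 'n"
  assumes "(\<Sum>k\<in>UNIV. b $ k) = d - 1" "d \<ge> 1"
  shows "((\<chi> k. real (b $ k)) - (real d - 1) *\<^sub>R axis i 1) \<bullet> x =
    (\<Sum>k\<in>UNIV. real (b $ k) * (x $ k - t)) - (real d - 1) * (x $ i - t)"
proof -
  have "(\<Sum>k\<in>UNIV. real (b $ k)) = real d - 1"
    using assms by (simp flip: of_nat_sum)
  then show ?thesis
    by (simp add: inner_exponent right_diff_distrib sum_subtractf flip: sum_distrib_right)
qed

lemma spread_le_exponent_bound:
  fixes B :: "'n::finite \<Rightarrow> (nat ^ 'n) set" and x :: "real ^ 'n"
  assumes d: "d \<ge> 1" and ne: "\<And>i. B i \<noteq> {}"
    and deg: "\<And>i b. b \<in> B i \<Longrightarrow> (\<Sum>k\<in>UNIV. b $ k) = d - 1"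
    and irr: "weakly_irreducible (poly_map B c)"
    and le: "\<And>a. a \<in> exponents d B \<Longrightarrow> a \<bullet> x \<le> \<epsilon>"
  shows "x $ k - x $ l \<le> \<epsilon> * real d ^ (CARD('n) - 1)"
proof -
  obtain m where m: "\<And>j. x $ m \<le> x $ j"
    using ex_is_arg_min_if_finite[of UNIV "($) x"] by (auto simp: is_arg_min_linorder)
  define y where "y i = x $ i - x $ m" for i
  have y: "y i \<ge> 0" for i using m by (simp add: y_def)
  have key: "(\<Sum>k\<in>UNIV. real (b $ k) * y k) \<le> \<epsilon> + (real d - 1) * y i" if "b \<in> B i" for b i
  proof -
    have "(\<chi> k. real (b $ k)) - (real d - 1) *\<^sub>R axis i 1 \<in> exponents d B"
      using that by (auto simp: exponents_def exponents_at_def)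
    from le[OF this] inner_exponent_shift[OF deg[OF that] d, where x = x and t = "x $ m" and i = i]
    show ?thesis by (simp add: y_def)
  qed
  \<comment> \<open>At the minimal index \<open>y m = 0\<close>, so \<open>key\<close> bounds a
    nonnegative sum by \<open>\<epsilon>\<close> alone.\<close>
  have "\<epsilon> \<ge> 0"
  proof -
    obtain b where "b \<in> B m" using ne by blast
    from key[OF this] have "(\<Sum>k\<in>UNIV. real (b $ k) * y k) \<le> \<epsilon>" by (simp add: y_def)
    moreover have "(\<Sum>k\<in>UNIV. real (b $ k) * y k) \<ge> 0" by (intro sum_nonneg) (simp add: y)
    ultimately show ?thesis by simp
  qed
  have "y k \<le> \<epsilon> * (1 + (real d - 1)) ^ (CARD('n) - 1)"
  proof (rule growth_bound_of_connected[where R = "\<lambda>i j. \<exists>b\<in>B i. b $ j > 0" and m = m])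
    fix i j assume "\<exists>b\<in>B i. b $ j > 0"
    then obtain b where b: "b \<in> B i" "b $ j > 0" by blast
    \<comment> \<open>A positive natural exponent is at least one.\<close>
    have "y j \<le> real (b $ j) * y j"
      using mult_right_mono[of 1 "real (b $ j)" "y j"] b(2) y by simp
    also have "\<dots> \<le> (\<Sum>k\<in>UNIV. real (b $ k) * y k)"
      by (rule member_le_sum) (simp_all add: y)
    finally show "y j \<le> \<epsilon> + (real d - 1) * y i" using key[OF b(1)] by simp
  qed (use d \<open>\<epsilon> \<ge> 0\<close> weakly_irreducible_poly_map_edge[OF irr] in \<open>auto simp: y_def\<close>)
  with m[of l] show ?thesis by (simp add: y_def)
qed

text \<open>Since the last coordinate vanishes, both \<open>x $ k\<close> and its negative are
  differences of coordinates, to which the spread bound applies.\<close>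

lemma infnorm_le_exponent_bound:
  fixes B :: "'n::{finite,linorder} \<Rightarrow> (nat, 'n) vec set" and x :: "(real, 'n) vec"
  assumes "d \<ge> 1" "\<And>i. B i \<noteq> {}"
    and "\<And>i b. b \<in> B i \<Longrightarrow> (\<Sum>k\<in>UNIV. b $ k) = d - 1"
    and "weakly_irreducible (poly_map B c)"
    and "\<And>a. a \<in> exponents d B \<Longrightarrow> a \<bullet> x \<le> \<epsilon>"
    and x: "x \<in> last_hyperplane"
  shows "infnorm x \<le> \<epsilon> * real d ^ (CARD('n) - 1)"
proof -
  have spread: "x $ k - x $ l \<le> \<epsilon> * real d ^ (CARD('n) - 1)" for k l
    by (rule spread_le_exponent_bound[where B = B and c = c]) (use assms in auto)
  have "\<bar>x $ k\<bar> \<le> \<epsilon> * real d ^ (CARD('n) - 1)" for k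
    using spread[of k "Max UNIV"] spread[of "Max UNIV" k] x by (simp add: last_hyperplane_def)
  then show ?thesis
    unfolding infnorm_cart by (intro cSup_least) auto
qed

section \<open>Coercivity\<close>

lemma continuous_on_Max_image:
  fixes g :: "'a \<Rightarrow> 'b::topological_space \<Rightarrow> real"
  assumes "finite I" "I \<noteq> {}" "\<And>i. i \<in> I \<Longrightarrow> continuous_on S (g i)"
  shows "continuous_on S (\<lambda>x. MAX i\<in>I. g i x)"
  using assms
proof (induction I rule: finite_ne_induct)
  case (insert i I)
  have "(\<lambda>x. MAX i\<in>insert i I. g i x) = (\<lambda>x. max (g i x) (MAX i\<in>I. g i x))"
    using insert.hyps by (simp add: fun_eq_iff)
  moreover have "continuous_on S (\<lambda>x. max (g i x) (MAX i\<in>I. g i x))"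
    by (intro continuous_on_max insert.IH insert.prems) auto
  ultimately show ?case by (simp only:)
qed simp

lemma monomial_vec_exp_vec: "monomial_vec (exp_vec x) b = exp (\<Sum>k\<in>UNIV. real (b $ k) * x $ k)"
  by (simp add: monomial_vec_def exp_vec_def exp_sum exp_of_nat_mult)

lemma continuous_on_log_max_fun:
  fixes B :: "'n::finite \<Rightarrow> (nat ^ 'n) set"
  assumes "\<And>i. finite (B i)" "\<And>i. B i \<noteq> {}" "\<And>i b. b \<in> B i \<Longrightarrow> c i b > 0"
  shows "continuous_on S (log_max_fun d (poly_map B c))"
proof -
  have "poly_map B c (exp_vec x) $ i > 0" for x i
    using assms by (auto simp: poly_map_def monomial_vec_exp_vec intro!: sum_pos)
  then have "poly_map B c (exp_vec x) $ i \<noteq> 0" for x i by (simp add: less_imp_neq[symmetric])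
  moreover have "continuous_on S (\<lambda>x. poly_map B c (exp_vec x) $ i)" for i
    unfolding poly_map_def monomial_vec_exp_vec by (simp add: continuous_intros)
  ultimately have ln_cont: "continuous_on S (\<lambda>x. ln (poly_map B c (exp_vec x) $ i))" for i
    by (intro continuous_on_ln) auto
  show ?thesis
    unfolding log_max_fun_def[abs_def]
    by (intro continuous_on_Max_image continuous_on_diff ln_cont continuous_on_mult_left
        continuous_on_component continuous_on_id) auto
qed

text \<open>All terms of the i-th component are positive, so it dominates each single term, whose
  logarithm is affine in \<open>x\<close>.\<close>

lemma exponent_le_log_max_fun:
  fixes B :: "'n::finite \<Rightarrow> (nat ^ 'n) set"
  assumes fin: "\<And>i. finite (B i)" and pos: "\<And>i b. b \<in> B i \<Longrightarrow> c i b > 0" and b: "b \<in> B i"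
  shows "((\<chi> k. real (b $ k)) - (real d - 1) *\<^sub>R axis i 1) \<bullet> x + ln (of_rat (c i b))
    \<le> log_max_fun d (poly_map B c) x"
proof -
  have c: "of_rat (c i b) > (0::real)" using pos[OF b] by simp
  let ?m = "of_rat (c i b) * monomial_vec (exp_vec x) b"
  have "?m \<le> poly_map B c (exp_vec x) $ i"
    unfolding poly_map_def vec_lambda_beta
    by (rule member_le_sum[OF b _ fin]) (simp add: monomial_vec_exp_vec pos less_imp_le)
  moreover have "?m > 0" using c by (simp add: monomial_vec_exp_vec)
  ultimately have "ln ?m \<le> ln (poly_map B c (exp_vec x) $ i)" by simp
  moreover have "ln ?m = ln (of_rat (c i b)) + (\<Sum>k\<in>UNIV. real (b $ k) * x $ k)"
    using c by (simp add: monomial_vec_exp_vec ln_mult)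
  moreover have "ln (poly_map B c (exp_vec x) $ i) - (real d - 1) * x $ i
      \<le> log_max_fun d (poly_map B c) x"
    unfolding log_max_fun_def by (rule Max_ge) auto
  ultimately show ?thesis
    by (simp add: inner_exponent)
qed

lemma coercive_on_log_max_fun:
  fixes B :: "'n::{finite,linorder} \<Rightarrow> (nat, 'n) vec set"
  assumes "d \<ge> 1" "\<And>i. finite (B i)" "\<And>i. B i \<noteq> {}"
    and "\<And>i b. b \<in> B i \<Longrightarrow> (\<Sum>k\<in>UNIV. b $ k) = d - 1"
    and "\<And>i b. b \<in> B i \<Longrightarrow> c i b > 0"
    and "weakly_irreducible (poly_map B c)"
  shows "coercive_on last_hyperplane (log_max_fun d (poly_map B c))"
  unfolding coercive_on_def
proof (rule allI)
  fix \<alpha>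
  let ?f = "log_max_fun d (poly_map B c)"
  let ?S = "{x \<in> last_hyperplane. ?f x \<le> \<alpha>}"
  \<comment> \<open>The least log-coefficient turns \<open>?f x \<le> \<alpha>\<close> into the
    uniform bound \<open>\<alpha> - Min ?C\<close> on all exponents.\<close>
  let ?C = "(\<lambda>(i, b). ln (of_rat (c i b) :: real)) ` Sigma UNIV B"
  have C: "Min ?C \<le> ln (of_rat (c i b))" if "b \<in> B i" for i b
    using that assms(2) by (intro Min_le) auto
  have "infnorm x \<le> (\<alpha> - Min ?C) * real d ^ (CARD('n) - 1)" if "x \<in> ?S" for x
  proof (rule infnorm_le_exponent_bound[where B = B and c = c, OF assms(1,3,4,6)])
    fix a assume "a \<in> exponents d B"
    then obtain i b where b: "b \<in> B i"
        and a: "a = (\<chi> k. real (b $ k)) - (real d - 1) *\<^sub>R axis i 1"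
      by (auto simp: exponents_def exponents_at_def)
    have "a \<bullet> x + ln (of_rat (c i b)) \<le> ?f x"
      unfolding a
      by (rule exponent_le_log_max_fun[where B = B and c = c and i = i and b = b, OF assms(2,5) b])
    with C[OF b] that show "a \<bullet> x \<le> \<alpha> - Min ?C" by simp
  qed (use that in auto)
  then have "bounded ?S"
    unfolding bounded_iff
    by (intro exI[of _ "sqrt DIM((real, 'n) vec) * ((\<alpha> - Min ?C) * real d ^ (CARD('n) - 1))"] ballI
        order_trans[OF norm_le_infnorm] mult_left_mono) auto
  moreover have "closed ?S"
    unfolding last_hyperplane_def mem_Collect_eq
    by (intro closed_Collect_conj closed_Collect_eq closed_Collect_le continuous_intros
        continuous_on_log_max_fun assms)
  ultimately show "compact ?S" by (simp add: compact_eq_bounded_closed)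
qed

section \<open>The coercivity constant\<close>

lemma powr_neg_half_le_inverse_power:
  assumes "0 < a" "a\<^sup>2 \<le> (s::real)"
  shows "s powr (- real m / 2) \<le> 1 / a ^ m"
proof -
  have "a ^ m = (a powr 2) powr (real m / 2)"
    unfolding powr_powr using assms(1) by (simp add: powr_realpow)
  also have "\<dots> = (a\<^sup>2) powr (real m / 2)"
    using assms(1) by simp
  also have "\<dots> \<le> s powr (real m / 2)"
    using assms by (intro powr_mono2) auto
  finally have "a ^ m \<le> s powr (real m / 2)" .
  then show ?thesis
    using assms(1) by (simp add: powr_minus_divide frac_le)
qed

theorem lemma1p4:
  fixes d :: nat
    and B :: "'n::{finite,linorder} \<Rightarrow> (nat, 'n) vec set"
    and c :: "'n \<Rightarrow> (nat, 'n) vec \<Rightarrow> rat"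
  assumes "d \<ge> 2"
    and "\<And>i. finite (B i)"
    and "\<And>i. B i \<noteq> {}"
    and "\<And>i b. b \<in> B i \<Longrightarrow> (\<Sum>k\<in>UNIV. b $ k) = d - 1"
    and "\<And>i b. b \<in> B i \<Longrightarrow> c i b > 0"
    and "weakly_irreducible (poly_map B c)"
  shows "coercive_on last_hyperplane (log_max_fun d (poly_map B c))
    \<and> coercivity_const (exponents d B) last_hyperplane
        \<ge> ereal ((4 * (real d - 1)\<^sup>2 + 1) powr (- (real CARD('n) - 1) / 2))"
proof
  have d: "d \<ge> 1" using assms(1) by simp
  show "coercive_on last_hyperplane (log_max_fun d (poly_map B c))"
    by (rule coercive_on_log_max_fun[where B = B and c = c, OF d assms(2-6)])
  show "coercivity_const (exponents d B) last_hyperplane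
      \<ge> ereal ((4 * (real d - 1)\<^sup>2 + 1) powr (- (real CARD('n) - 1) / 2))"
    unfolding coercivity_const_def
  \<comment> \<open>This also covers \<open>CARD('n) = 1\<close>, where no point has norm one and
    the infimum is infinite.\<close>
  proof (rule INF_greatest)
    fix x :: "(real, 'n) vec" assume "x \<in> {x \<in> last_hyperplane. infnorm x = 1}"
    then have x: "x \<in> last_hyperplane" "infnorm x = 1" by auto
    let ?M = "MAX a\<in>exponents d B. a \<bullet> x"
    let ?m = "CARD('n) - 1"
    have "finite (exponents d B)" using assms(2) by (simp add: exponents_def exponents_at_def)
    then have "a \<bullet> x \<le> ?M" if "a \<in> exponents d B" for a using that by simp
    \<comment> \<open>The maximum \<open>?M\<close> itself serves as \<open>\<epsilon>\<close>,
      giving \<open>1 \<le> ?M * real d ^ ?m\<close>.\<close>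
    from infnorm_le_exponent_bound[where B = B and c = c, OF d assms(3,4,6) this x(1)] x(2)
    have "1 / real d ^ ?m \<le> ?M" using d by (simp add: divide_le_eq)
    moreover have "(real d)\<^sup>2 \<le> 4 * (real d - 1)\<^sup>2 + 1"
    proof -
      \<comment> \<open>This product is the difference of the two sides; its first factor is
        positive because \<open>d \<ge> 2\<close>.\<close>
      have "0 \<le> (3 * real d - 5) * (real d - 1)"
        using assms(1) by (intro mult_nonneg_nonneg) auto
      then show ?thesis by (simp add: power2_eq_square algebra_simps)
    qed
    then have "(4 * (real d - 1)\<^sup>2 + 1) powr (- real ?m / 2) \<le> 1 / real d ^ ?m"
      using d by (intro powr_neg_half_le_inverse_power) auto
    ultimately show "ereal ((4 * (real d - 1)\<^sup>2 + 1) powr (- (real CARD('n) - 1) / 2)) \<le> ereal ?M"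
      by (simp add: of_nat_diff Suc_leI)
  qed
qed

end
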